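(* Let $F$ be a Banach lattice. Then the following statements are equivalent. (1) Every order interval in $F$ is weakly precompact. (2) Every disjointly weakly compact set of $F$ is weakly precompact. (3) Every disjointly weakly compact operator from an arbitrary Banach space $X$ to $F$ is weakly precompact. (4) Every positive disjointly weakly compact operator from $\ell_1$ to $F$ is weakly precompact.
   Context: All Banach spaces and Banach lattices are real; $B_X$ is the closed unit ball of $X$. A sequence $(x_n)$ in a Banach lattice is disjoint if $|x_n|\wedge|x_m|=0$ for $n\neq m$. $Sol(A)=\{x: |x|\le |a| \text{ for some } a\in A\}$ is the solid hull of $A$. A norm bounded set $A$ in a Banach lattice is disjointly weakly compact if every disjoint sequence in $Sol(A)$ converges weakly to zero. A bounded linear operator $T$ from a Banach space $X$ to a Banach lattice is disjointly weakly compact if $T(B_X)$ is a disjointly weakly compact set. A bounded set $A$ in a Banach space is weakly precompact if every sequence in $A$ has a weakly Cauchy subsequence; an operator between Banach spaces is weakly precompact if it maps norm bounded sets to weakly precompact sets. *)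

theory Defs
  imports "HOL-Analysis.Analysis" "HOL-Library.Lattice_Algebras"
begin

section \<open>Banach lattices\<close>

class banach_lattice = banach + ordered_real_vector + lattice_ab_group_add_abs +
  assumes norm_mono_abs: "\<bar>x\<bar> \<le> \<bar>y\<bar> \<Longrightarrow> norm x \<le> norm y"

instance real :: banach_lattice
  by standard simp

definition disjoint_seq :: "(nat \<Rightarrow> 'a::banach_lattice) \<Rightarrow> bool" where
  "disjoint_seq x \<longleftrightarrow> (\<forall>n m. n \<noteq> m \<longrightarrow> inf \<bar>x n\<bar> \<bar>x m\<bar> = 0)"

definition solid_hull :: "'a::banach_lattice set \<Rightarrow> 'a set" where
  "solid_hull A = {x. \<exists>a\<in>A. \<bar>x\<bar> \<le> \<bar>a\<bar>}"

definition weakly_null :: "(nat \<Rightarrow> 'a::real_normed_vector) \<Rightarrow> bool" where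
  "weakly_null x \<longleftrightarrow> (\<forall>\<phi> :: 'a \<Rightarrow> real. bounded_linear \<phi> \<longrightarrow> (\<lambda>n. \<phi> (x n)) \<longlonglongrightarrow> 0)"

definition weakly_Cauchy :: "(nat \<Rightarrow> 'a::real_normed_vector) \<Rightarrow> bool" where
  "weakly_Cauchy x \<longleftrightarrow> (\<forall>\<phi> :: 'a \<Rightarrow> real. bounded_linear \<phi> \<longrightarrow> Cauchy (\<lambda>n. \<phi> (x n)))"

definition disjointly_weakly_compact :: "'a::banach_lattice set \<Rightarrow> bool" where
  "disjointly_weakly_compact A \<longleftrightarrow>
     bounded A \<and> (\<forall>x. range x \<subseteq> solid_hull A \<longrightarrow> disjoint_seq x \<longrightarrow> weakly_null x)"

definition weakly_precompact :: "'a::banach set \<Rightarrow> bool" where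
  "weakly_precompact A \<longleftrightarrow>
     bounded A \<and>
     (\<forall>x. range x \<subseteq> A \<longrightarrow> (\<exists>r :: nat \<Rightarrow> nat. strict_mono r \<and> weakly_Cauchy (x \<circ> r)))"


section \<open>Banach spaces as first-class objects\<close>

text \<open>
  The class \<open>banach\<close> does not allow quantification over all Banach spaces inside a formula,
  so the domains of operators are Banach spaces given by a carrier set with operations.
  Operations and operators are only constrained on the carrier.

  ``An arbitrary Banach space'' is rendered by quantifying over all values of type \<open>'u nvs\<close> that
  satisfy \<open>banach_space\<close>, for a type variable \<open>'u\<close> with \<open>UNIV :: real set \<lesssim> UNIV :: 'u set\<close>. As \<open>'u\<close>
  is universally quantified in theorems, Banach spaces of every size are covered; the
  cardinality condition excludes no nonzero space, since any such space contains a
  copy of the real line.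
\<close>

record 'x nvs =
  nvs_carrier :: "'x set"
  nvs_add :: "'x \<Rightarrow> 'x \<Rightarrow> 'x"
  nvs_zero :: "'x"
  nvs_scale :: "real \<Rightarrow> 'x \<Rightarrow> 'x"
  nvs_norm :: "'x \<Rightarrow> real"

text \<open>
  The locale \<open>Metric_space\<close> requires nonnegativity and symmetry of the distance on the whole type,
  hence the value \<open>0\<close> off the carrier.
\<close>

definition nvs_dist :: "'x nvs \<Rightarrow> 'x \<Rightarrow> 'x \<Rightarrow> real" where
  "nvs_dist X x y =
     (if x \<in> nvs_carrier X \<and> y \<in> nvs_carrier X
      then nvs_norm X (nvs_add X x (nvs_scale X (-1) y)) else 0)"

locale banach_space =
  fixes X :: "'x nvs"
  assumes add_closed: "\<lbrakk>x \<in> nvs_carrier X; y \<in> nvs_carrier X\<rbrakk> \<Longrightarrow> nvs_add X x y \<in> nvs_carrier X"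
    and zero_closed: "nvs_zero X \<in> nvs_carrier X"
    and scale_closed: "x \<in> nvs_carrier X \<Longrightarrow> nvs_scale X a x \<in> nvs_carrier X"
    and add_assoc: "\<lbrakk>x \<in> nvs_carrier X; y \<in> nvs_carrier X; z \<in> nvs_carrier X\<rbrakk> \<Longrightarrow>
      nvs_add X (nvs_add X x y) z = nvs_add X x (nvs_add X y z)"
    and add_commute: "\<lbrakk>x \<in> nvs_carrier X; y \<in> nvs_carrier X\<rbrakk> \<Longrightarrow>
      nvs_add X x y = nvs_add X y x"
    and add_zero: "x \<in> nvs_carrier X \<Longrightarrow> nvs_add X x (nvs_zero X) = x"
    and add_inverse: "x \<in> nvs_carrier X \<Longrightarrow> \<exists>y\<in>nvs_carrier X. nvs_add X x y = nvs_zero X"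
    and scale_add_right: "\<lbrakk>x \<in> nvs_carrier X; y \<in> nvs_carrier X\<rbrakk> \<Longrightarrow>
      nvs_scale X a (nvs_add X x y) = nvs_add X (nvs_scale X a x) (nvs_scale X a y)"
    and scale_add_left: "x \<in> nvs_carrier X \<Longrightarrow>
      nvs_scale X (a + b) x = nvs_add X (nvs_scale X a x) (nvs_scale X b x)"
    and scale_scale: "x \<in> nvs_carrier X \<Longrightarrow>
      nvs_scale X a (nvs_scale X b x) = nvs_scale X (a * b) x"
    and scale_one: "x \<in> nvs_carrier X \<Longrightarrow> nvs_scale X 1 x = x"
    and norm_nonneg: "x \<in> nvs_carrier X \<Longrightarrow> 0 \<le> nvs_norm X x"
    and norm_eq_zero: "x \<in> nvs_carrier X \<Longrightarrow> nvs_norm X x = 0 \<longleftrightarrow> x = nvs_zero X"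
    and norm_scale: "x \<in> nvs_carrier X \<Longrightarrow> nvs_norm X (nvs_scale X a x) = \<bar>a\<bar> * nvs_norm X x"
    and norm_triangle: "\<lbrakk>x \<in> nvs_carrier X; y \<in> nvs_carrier X\<rbrakk> \<Longrightarrow>
      nvs_norm X (nvs_add X x y) \<le> nvs_norm X x + nvs_norm X y"
    and complete: "Metric_space.mcomplete (nvs_carrier X) (nvs_dist X)"

definition nvs_unit_ball :: "'x nvs \<Rightarrow> 'x set" where
  "nvs_unit_ball X = {x \<in> nvs_carrier X. nvs_norm X x \<le> 1}"

definition nvs_bounded :: "'x nvs \<Rightarrow> 'x set \<Rightarrow> bool" where
  "nvs_bounded X A \<longleftrightarrow> A \<subseteq> nvs_carrier X \<and> (\<exists>K. \<forall>x\<in>A. nvs_norm X x \<le> K)"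

definition bounded_operator :: "'x nvs \<Rightarrow> ('x \<Rightarrow> 'a::real_normed_vector) \<Rightarrow> bool" where
  "bounded_operator X T \<longleftrightarrow>
     (\<forall>x\<in>nvs_carrier X. \<forall>y\<in>nvs_carrier X. T (nvs_add X x y) = T x + T y) \<and>
     (\<forall>a. \<forall>x\<in>nvs_carrier X. T (nvs_scale X a x) = a *\<^sub>R T x) \<and>
     (\<exists>K. \<forall>x\<in>nvs_carrier X. norm (T x) \<le> K * nvs_norm X x)"

definition disjointly_weakly_compact_operator ::
    "'x nvs \<Rightarrow> ('x \<Rightarrow> 'a::banach_lattice) \<Rightarrow> bool" where
  "disjointly_weakly_compact_operator X T \<longleftrightarrow>
     bounded_operator X T \<and> disjointly_weakly_compact (T ` nvs_unit_ball X)"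

definition weakly_precompact_operator :: "'x nvs \<Rightarrow> ('x \<Rightarrow> 'a::banach) \<Rightarrow> bool" where
  "weakly_precompact_operator X T \<longleftrightarrow>
     bounded_operator X T \<and> (\<forall>A. nvs_bounded X A \<longrightarrow> weakly_precompact (T ` A))"


section \<open>The Banach lattice \<open>\<ell>\<^sub>1\<close>\<close>

definition ell1 :: "(nat \<Rightarrow> real) nvs" where
  "ell1 = \<lparr> nvs_carrier = {x. summable (\<lambda>n. \<bar>x n\<bar>)},
            nvs_add = (\<lambda>x y n. x n + y n),
            nvs_zero = (\<lambda>n. 0),
            nvs_scale = (\<lambda>a x n. a * x n),
            nvs_norm = (\<lambda>x. \<Sum>n. \<bar>x n\<bar>) \<rparr>"

text \<open>Positivity of operators refers to the coordinatewise order of \<open>\<ell>\<^sub>1\<close>.\<close>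

definition positive_on_ell1 :: "((nat \<Rightarrow> real) \<Rightarrow> 'a::banach_lattice) \<Rightarrow> bool" where
  "positive_on_ell1 T \<longleftrightarrow> (\<forall>x\<in>nvs_carrier ell1. (\<forall>n. 0 \<le> x n) \<longrightarrow> 0 \<le> T x)"

lemma summable_abs_add:
  fixes x y :: "nat \<Rightarrow> real"
  assumes "summable (\<lambda>n. \<bar>x n\<bar>)" "summable (\<lambda>n. \<bar>y n\<bar>)"
  shows "summable (\<lambda>n. \<bar>x n + y n\<bar>)"
  by (rule summable_comparison_test'[OF summable_add[OF assms], of 0]) (auto simp: abs_triangle_ineq)

lemma nvs_dist_ell1:
  "summable (\<lambda>n. \<bar>x n\<bar>) \<Longrightarrow> summable (\<lambda>n. \<bar>y n\<bar>) \<Longrightarrow> nvs_dist ell1 x y = (\<Sum>n. \<bar>x n - y n\<bar>)"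
  by (simp add: nvs_dist_def ell1_def)

lemma summable_abs_diff:
  fixes x y :: "nat \<Rightarrow> real"
  assumes "summable (\<lambda>n. \<bar>x n\<bar>)" "summable (\<lambda>n. \<bar>y n\<bar>)"
  shows "summable (\<lambda>n. \<bar>x n - y n\<bar>)"
  using summable_abs_add[of x "\<lambda>n. - y n"] assms by simp

lemma Metric_space_ell1: "Metric_space (nvs_carrier ell1) (nvs_dist ell1)"
proof
  show "0 \<le> nvs_dist ell1 x y" for x y
    by (auto simp: nvs_dist_def ell1_def intro!: suminf_nonneg summable_abs_diff)
  show "nvs_dist ell1 x y = nvs_dist ell1 y x" for x y
    by (simp add: nvs_dist_def ell1_def abs_minus_commute)
next
  fix x y z assume "x \<in> nvs_carrier ell1" "y \<in> nvs_carrier ell1"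
  then have s: "summable (\<lambda>n. \<bar>x n\<bar>)" "summable (\<lambda>n. \<bar>y n\<bar>)"
    by (auto simp: ell1_def)
  show "nvs_dist ell1 x y = 0 \<longleftrightarrow> x = y"
    using suminf_eq_zero_iff[OF summable_abs_diff[OF s]]
    by (auto simp: nvs_dist_ell1 s fun_eq_iff)
  assume "z \<in> nvs_carrier ell1"
  then have z: "summable (\<lambda>n. \<bar>z n\<bar>)" by (auto simp: ell1_def)
  show "nvs_dist ell1 x z \<le> nvs_dist ell1 x y + nvs_dist ell1 y z"
    unfolding nvs_dist_ell1[OF s] nvs_dist_ell1[OF s(1) z] nvs_dist_ell1[OF s(2) z]
      suminf_add[OF summable_abs_diff[OF s] summable_abs_diff[OF s(2) z]]
    by (rule suminf_le[OF _ summable_abs_diff[OF s(1) z]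
          summable_add[OF summable_abs_diff[OF s] summable_abs_diff[OF s(2) z]]]) linarith
qed

lemma mcomplete_ell1: "Metric_space.mcomplete (nvs_carrier ell1) (nvs_dist ell1)"
proof -
  interpret Metric_space "nvs_carrier ell1" "nvs_dist ell1"
    by (rule Metric_space_ell1)
  show ?thesis
    unfolding mcomplete_def
  proof (intro allI impI)
    fix \<sigma> assume C: "MCauchy \<sigma>"
    then have s: "summable (\<lambda>k. \<bar>\<sigma> n k\<bar>)" for n
      unfolding MCauchy_def by (auto simp: ell1_def)
    have part: "(\<Sum>k<K. \<bar>\<sigma> n k - \<sigma> m k\<bar>) \<le> nvs_dist ell1 (\<sigma> n) (\<sigma> m)" for n m K
      unfolding nvs_dist_ell1[OF s s] by (rule sum_le_suminf) (auto intro: summable_abs_diff s)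
    have cauchy: "\<exists>N. \<forall>n\<ge>N. \<forall>m\<ge>N. nvs_dist ell1 (\<sigma> n) (\<sigma> m) < e" if "e > 0" for e
    proof -
      from C have "\<forall>e>0. \<exists>N. \<forall>n m. N \<le> n \<longrightarrow> N \<le> m \<longrightarrow> nvs_dist ell1 (\<sigma> n) (\<sigma> m) < e"
        unfolding MCauchy_def by (rule conjunct2)
      then show ?thesis
        using that by (meson order_refl)
    qed
    have "Cauchy (\<lambda>n. \<sigma> n k)" for k
    proof (rule metric_CauchyI)
      fix e :: real assume "e > 0"
      then obtain N where N: "\<And>n m. n \<ge> N \<Longrightarrow> m \<ge> N \<Longrightarrow> nvs_dist ell1 (\<sigma> n) (\<sigma> m) < e"
        using cauchy by blast
      have coord: "\<bar>\<sigma> n k - \<sigma> m k\<bar> \<le> (\<Sum>k<Suc k. \<bar>\<sigma> n k - \<sigma> m k\<bar>)" for n m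
        by (simp add: sum_nonneg)
      have "\<bar>\<sigma> n k - \<sigma> m k\<bar> < e" if "n \<ge> N" "m \<ge> N" for n m
        by (rule le_less_trans[OF order_trans[OF coord part] N[OF that]])
      then show "\<exists>M. \<forall>m\<ge>M. \<forall>n\<ge>M. dist (\<sigma> m k) (\<sigma> n k) < e"
        unfolding dist_real_def by (intro exI[of _ N]) simp
    qed
    then have x: "(\<lambda>n. \<sigma> n k) \<longlonglongrightarrow> lim (\<lambda>n. \<sigma> n k)" for k
      by (simp add: Cauchy_convergent convergent_LIMSEQ_iff[symmetric])
    define x where "x = (\<lambda>k. lim (\<lambda>n. \<sigma> n k))"
    have x: "(\<lambda>n. \<sigma> n k) \<longlonglongrightarrow> x k" for k
      unfolding x_def by (rule x)
    have tail: "\<exists>N. \<forall>n\<ge>N. summable (\<lambda>k. \<bar>\<sigma> n k - x k\<bar>) \<and> (\<Sum>k. \<bar>\<sigma> n k - x k\<bar>) \<le> e"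
      if "e > 0" for e
    proof -
      obtain N where N: "\<And>n m. n \<ge> N \<Longrightarrow> m \<ge> N \<Longrightarrow> nvs_dist ell1 (\<sigma> n) (\<sigma> m) < e"
        using cauchy[OF \<open>e > 0\<close>] by blast
      have "summable (\<lambda>k. \<bar>\<sigma> n k - x k\<bar>) \<and> (\<Sum>k. \<bar>\<sigma> n k - x k\<bar>) \<le> e" if n: "n \<ge> N" for n
      proof -
        have le: "(\<Sum>k<K. \<bar>\<sigma> n k - x k\<bar>) \<le> e" for K
        proof (rule LIMSEQ_le_const2)
          show "(\<lambda>m. \<Sum>k<K. \<bar>\<sigma> n k - \<sigma> m k\<bar>) \<longlonglongrightarrow> (\<Sum>k<K. \<bar>\<sigma> n k - x k\<bar>)"
            by (intro tendsto_intros x)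
          show "\<exists>M. \<forall>m\<ge>M. (\<Sum>k<K. \<bar>\<sigma> n k - \<sigma> m k\<bar>) \<le> e"
            using less_imp_le[OF le_less_trans[OF part N[OF n]]] by blast
        qed
        have "summable (\<lambda>k. \<bar>\<sigma> n k - x k\<bar>)"
          by (rule summableI_nonneg_bounded[OF _ le]) simp
        then show ?thesis
          using le by (simp add: suminf_le_const)
      qed
      then show ?thesis by blast
    qed
    obtain N where "summable (\<lambda>k. \<bar>\<sigma> N k - x k\<bar>)"
      using tail[of 1] by auto
    from summable_abs_diff[OF s[of N] this] have xs: "x \<in> nvs_carrier ell1"
      by (simp add: ell1_def)
    have "limitin mtopology \<sigma> x sequentially"
      unfolding limit_metric_sequentially
    proof (intro conjI allI impI)
      fix e :: real assume "e > 0"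
      then obtain N where N: "\<And>n. n \<ge> N \<Longrightarrow> (\<Sum>k. \<bar>\<sigma> n k - x k\<bar>) \<le> e / 2"
        using tail[of "e / 2"] by auto
      have "nvs_dist ell1 (\<sigma> n) x < e" if "n \<ge> N" for n
        using N[OF that] \<open>e > 0\<close> nvs_dist_ell1[OF s[of n]] xs by (simp add: ell1_def)
      moreover have "\<sigma> n \<in> nvs_carrier ell1" for n
        using s by (simp add: ell1_def)
      ultimately show "\<exists>N. \<forall>n\<ge>N. \<sigma> n \<in> nvs_carrier ell1 \<and> nvs_dist ell1 (\<sigma> n) x < e"
        by blast
    qed (use xs in auto)
    then show "\<exists>x. limitin mtopology \<sigma> x sequentially" by blast
  qed
qed

lemma banach_space_ell1: "banach_space ell1"
proof
  show "\<exists>y\<in>nvs_carrier ell1. nvs_add ell1 x y = nvs_zero ell1" if "x \<in> nvs_carrier ell1" for x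
    by (rule bexI[of _ "\<lambda>n. - x n"]) (use that in \<open>auto simp: ell1_def\<close>)
  show "nvs_norm ell1 (nvs_add ell1 x y) \<le> nvs_norm ell1 x + nvs_norm ell1 y"
    if "x \<in> nvs_carrier ell1" "y \<in> nvs_carrier ell1" for x y
  proof -
    from that have s: "summable (\<lambda>n. \<bar>x n\<bar>)" "summable (\<lambda>n. \<bar>y n\<bar>)"
      by (auto simp: ell1_def)
    have "(\<Sum>n. \<bar>x n + y n\<bar>) \<le> (\<Sum>n. \<bar>x n\<bar> + \<bar>y n\<bar>)"
      by (rule suminf_le[OF abs_triangle_ineq summable_abs_add[OF s] summable_add[OF s]])
    then show ?thesis
      by (simp add: ell1_def suminf_add[OF s])
  qed
  show "nvs_norm ell1 x = 0 \<longleftrightarrow> x = nvs_zero ell1" if "x \<in> nvs_carrier ell1" for x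
    using that suminf_eq_zero_iff[of "\<lambda>n. \<bar>x n\<bar>"] by (auto simp: ell1_def fun_eq_iff)
  show "nvs_norm ell1 (nvs_scale ell1 a x) = \<bar>a\<bar> * nvs_norm ell1 x"
    if "x \<in> nvs_carrier ell1" for a x
    using that by (simp add: ell1_def abs_mult suminf_mult)
  show "Metric_space.mcomplete (nvs_carrier ell1) (nvs_dist ell1)"
    by (rule mcomplete_ell1)
qed (simp_all add: ell1_def algebra_simps abs_mult suminf_nonneg summable_abs_add summable_mult)

end

theory Submission
  imports Defs "HOL-Library.Diagonal_Subsequence"
begin

text \<open>
  The substantial implication is from order intervals to disjointly weakly compact sets. Given a
  sequence \<open>x\<^sub>n\<close> in such a set, put \<open>z = \<Sum> 2\<^sup>-\<^sup>n \<bar>x\<^sub>n\<bar>\<close>. The truncations of the \<open>x\<^sub>n\<close> to \<open>[-kz, kz]\<close> have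
  weakly Cauchy subsequences for each \<open>k\<close>, and a diagonal subsequence serves all \<open>k\<close>. For every
  functional the truncation error is small uniformly in \<open>n\<close> for some \<open>k\<close>, since otherwise the
  solid hull would contain a disjoint sequence that is not weakly null. So the diagonal subsequence
  of the \<open>x\<^sub>n\<close> is itself weakly Cauchy, and no form of Rosenthal's theorem is needed.

  Conversely, a sequence in \<open>[0, u]\<close> is the image of the unit vectors under a positive operator on
  \<open>\<ell>\<^sub>1\<close> that maps the unit ball into \<open>[-u, u]\<close>, and order intervals are disjointly weakly compact.
\<close>

section \<open>Lattice inequalities\<close>

text \<open>For \<open>0 \<le> c\<close>, the lattice form of truncating a real function to the band
  between \<open>- c\<close> and \<open>c\<close>.\<close>

definition clip :: "'a::banach_lattice \<Rightarrow> 'a \<Rightarrow> 'a" where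
  "clip c y = sup (- c) (inf c y)"

lemma clip_mem:
  assumes "0 \<le> c"
  shows "clip c y \<in> {- c..c}"
  using assms by (simp add: clip_def le_infI1 order_trans[of "- c" 0 c])

lemma abs_clip_le:
  assumes "0 \<le> c"
  shows "\<bar>clip c y\<bar> \<le> c"
  using clip_mem[OF assms, of y] by (intro abs_leI) (auto simp: minus_le_iff)

text \<open>The truncation lies above \<open>inf c y\<close>, which bounds the remainder from above.
  Its negative is a supremum of \<open>- c - y\<close>, which is at most
  \<open>\<bar>y\<bar> - c\<close>, and \<open>inf c y - y\<close>, which is at most 0.\<close>

lemma abs_diff_clip_le: "\<bar>y - clip c y\<bar> \<le> sup 0 (\<bar>y\<bar> - c)"
proof (rule abs_leI)
  have "y - clip c y \<le> y - inf c y"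
    by (simp add: clip_def)
  also have "\<dots> = sup (y - c) 0"
    by (simp add: diff_inf_eq_sup add_sup_distrib_left)
  also have "\<dots> \<le> sup 0 (\<bar>y\<bar> - c)"
    by (simp add: le_supI2 abs_ge_self)
  finally show "y - clip c y \<le> sup 0 (\<bar>y\<bar> - c)" .
  have "- (y - clip c y) = sup (- c - y) (inf c y - y)"
    using add_sup_distrib_right[of "- c" "inf c y" "- y"] by (simp add: clip_def)
  also have "\<dots> \<le> sup 0 (\<bar>y\<bar> - c)"
    by (intro sup_least le_supI1[of "inf c y - y"] le_supI2[of "- c - y"])
      (use abs_ge_minus_self[of y] in \<open>auto simp: algebra_simps\<close>)
  finally show "- (y - clip c y) \<le> sup 0 (\<bar>y\<bar> - c)" .
qed

lemma abs_diff_clip_le_abs: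
  assumes "0 \<le> c"
  shows "\<bar>y - clip c y\<bar> \<le> \<bar>y\<bar>"
  using assms by (intro order_trans[OF abs_diff_clip_le]) simp

text \<open>The first term is the positive part of \<open>a - t *\<^sub>R b\<close>, the second is
  \<open>1 / t\<close> times its negative part, and these parts are disjoint. Since
  \<open>t \<le> 1\<close>, multiplying the infimum by \<open>t\<close> keeps it below both
  parts.\<close>

lemma inf_sup_diff_eq_0:
  fixes a b :: "'a::banach_lattice"
  assumes "0 < t" "t \<le> 1"
  shows "inf (sup 0 (a - t *\<^sub>R b)) (sup 0 (b - (1 / t) *\<^sub>R a)) = 0"
    (is "?d = 0")
proof -
  let ?m = "a - t *\<^sub>R b"
  have d0: "0 \<le> ?d" by simp
  have "t *\<^sub>R ?d \<le> ?d"
    using scaleR_right_mono[OF \<open>t \<le> 1\<close> d0] by simp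
  then have 1: "t *\<^sub>R ?d \<le> sup 0 ?m"
    by (rule order_trans) simp
  have "sup 0 (b - (1 / t) *\<^sub>R a) \<le> (1 / t) *\<^sub>R sup 0 (- ?m)"
  proof (rule sup_least)
    show "0 \<le> (1 / t) *\<^sub>R sup 0 (- ?m)"
      using assms by (intro scaleR_nonneg_nonneg) auto
    have "b - (1 / t) *\<^sub>R a = (1 / t) *\<^sub>R (- ?m)"
      using assms by (simp add: algebra_simps)
    also have "\<dots> \<le> (1 / t) *\<^sub>R sup 0 (- ?m)"
      using assms by (intro scaleR_left_mono) auto
    finally show "b - (1 / t) *\<^sub>R a \<le> (1 / t) *\<^sub>R sup 0 (- ?m)" .
  qed
  then have "?d \<le> (1 / t) *\<^sub>R sup 0 (- ?m)"
    by (rule le_infI2)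
  from scaleR_left_mono[OF this, of t] assms have 2: "t *\<^sub>R ?d \<le> sup 0 (- ?m)"
    by simp
  have "inf (sup 0 ?m) (sup 0 (- ?m)) = inf (pprt ?m) (pprt (- ?m))"
    by (simp add: pprt_def sup_commute)
  also have "\<dots> = 0"
  proof -
    \<comment> \<open>Translation by \<open>nprt ?m\<close> turns the infimum of the two parts into
      \<open>inf ?m 0\<close>, which is \<open>nprt ?m\<close> again.\<close>
    have "inf (pprt ?m) (- nprt ?m) + nprt ?m = inf (pprt ?m + nprt ?m) 0"
      by (simp add: add_inf_distrib_right)
    also have "\<dots> = nprt ?m"
      by (simp only: prts[symmetric]) (simp add: nprt_def)
    finally show ?thesis
      by (simp only: pprt_neg) simp
  qed
  finally have "t *\<^sub>R ?d \<le> 0"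
    using 1 2 by (metis le_inf_iff)
  from scaleR_left_mono[OF this, of "1 / t"] assms have "?d \<le> 0"
    by simp
  then show ?thesis
    using d0 by (rule order_antisym)
qed

lemma inf_eq_0_mono:
  fixes a b :: "'a::banach_lattice"
  assumes "inf a b = 0" "0 \<le> a'" "a' \<le> a" "0 \<le> b'" "b' \<le> b"
  shows "inf a' b' = 0"
  using assms by (metis inf_mono le_inf_iff order_antisym)

text \<open>Subtracting \<open>a\<close> from the infimum leaves an element below both
  \<open>b\<close> and \<open>c\<close>, hence below 0. So the infimum is below \<open>a\<close> as
  well as \<open>c\<close>.\<close>

lemma inf_add_eq_0:
  fixes a b c :: "'a::banach_lattice"
  assumes "0 \<le> a" "0 \<le> b" "0 \<le> c" "inf a c = 0" "inf b c = 0"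
  shows "inf (a + b) c = 0"
proof (rule order_antisym)
  let ?d = "inf (a + b) c"
  have "?d - a \<le> b" "?d - a \<le> c"
    using assms(1) by (auto simp: diff_le_eq add.commute intro: le_infI1 le_infI2 add_increasing2)
  then have "?d - a \<le> inf b c"
    by (rule le_infI)
  then have "?d \<le> a"
    using assms(5) by simp
  then have "?d \<le> inf a c"
    by simp
  then show "?d \<le> 0"
    using assms(4) by simp
qed (use assms in simp)

text \<open>A sum of disjoint positive elements is their supremum: each new term is disjoint from
  the partial sum before it, and \<open>x + y = inf x y + sup x y\<close>.\<close>

lemma sum_disjoint_le:
  fixes a :: "nat \<Rightarrow> 'a::banach_lattice"
  assumes pos: "\<And>n. 0 \<le> a n" and le: "\<And>n. a n \<le> u"
    and disj: "\<And>m n. m \<noteq> n \<Longrightarrow> inf (a m) (a n) = 0"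
  shows "(\<Sum>n<N. a n) \<le> u"
proof (induction N)
  case 0
  show ?case using pos[of 0] le[of 0] by simp
next
  case (Suc N)
  have "inf (\<Sum>n<M. a n) (a N) = 0" if "M \<le> N" for M
    using that
  proof (induction M)
    case 0
    then show ?case by (simp add: inf_absorb1 pos)
  next
    case (Suc M)
    then show ?case by (simp add: inf_add_eq_0 sum_nonneg pos disj)
  qed
  from this[of N] have "(\<Sum>n<Suc N. a n) = sup (\<Sum>n<N. a n) (a N)"
    using add_eq_inf_sup[of "\<Sum>n<N. a n" "a N"] by simp
  then show ?case
    using Suc le by simp
qed

section \<open>Monotonicity of the norm, closedness of the positive cone, and series\<close>

lemma norm_abs_lattice [simp]: "norm \<bar>x\<bar> = norm (x::'a::banach_lattice)"
  by (intro order_antisym norm_mono_abs) auto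

lemma norm_mono_nonneg:
  fixes x y :: "'a::banach_lattice"
  shows "0 \<le> x \<Longrightarrow> x \<le> y \<Longrightarrow> norm x \<le> norm y"
  by (intro norm_mono_abs) (metis abs_of_nonneg order_trans)

lemma norm_le_if_abs_le:
  fixes x u :: "'a::banach_lattice"
  shows "\<bar>x\<bar> \<le> u \<Longrightarrow> norm x \<le> norm u"
  by (metis abs_ge_zero norm_abs_lattice norm_mono_nonneg)

lemma abs_scaleR_le:
  fixes x :: "'a::banach_lattice"
  shows "\<bar>a *\<^sub>R x\<bar> \<le> \<bar>a\<bar> *\<^sub>R \<bar>x\<bar>"
proof -
  have *: "r *\<^sub>R x \<le> \<bar>r\<bar> *\<^sub>R \<bar>x\<bar>" for r
  proof (cases "0 \<le> r")
    case True
    then show ?thesis using scaleR_left_mono[OF abs_ge_self[of x]] by simp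
  next
    case False
    then have "(- r) *\<^sub>R (- x) \<le> (- r) *\<^sub>R \<bar>x\<bar>"
      by (intro scaleR_left_mono) (auto simp: abs_ge_minus_self)
    then show ?thesis using False by simp
  qed
  show ?thesis
    using *[of a] *[of "- a"] by (intro abs_leI) auto
qed

text \<open>The negative part of the limit is dominated by \<open>\<bar>X n - x\<bar>\<close>, so
  its norm is 0.\<close>

lemma LIMSEQ_nonneg:
  fixes X :: "nat \<Rightarrow> 'a::banach_lattice"
  assumes lim: "X \<longlonglongrightarrow> x" and pos: "\<And>n. 0 \<le> X n"
  shows "0 \<le> x"
proof -
  have "norm (sup 0 (- x)) \<le> norm (X n - x)" for n
  proof -
    have "- x \<le> X n - x"
      using pos[of n] by simp
    then have "sup 0 (- x) \<le> \<bar>X n - x\<bar>"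
      by (meson abs_ge_self abs_ge_zero order_trans sup_least)
    then have "norm (sup 0 (- x)) \<le> norm \<bar>X n - x\<bar>"
      by (intro norm_mono_nonneg) auto
    then show ?thesis by simp
  qed
  moreover have "(\<lambda>n. norm (X n - x)) \<longlonglongrightarrow> 0"
    using lim by (simp add: LIM_zero tendsto_norm_zero)
  ultimately have "norm (sup 0 (- x)) \<le> 0"
    by (intro LIMSEQ_le_const) auto
  then have "sup 0 (- x) = 0" by simp
  then have "- x \<le> 0" by (metis sup_ge2)
  then show ?thesis by simp
qed

lemma LIMSEQ_le_lattice:
  fixes X :: "nat \<Rightarrow> 'a::banach_lattice"
  assumes "X \<longlonglongrightarrow> x" "\<And>n. X n \<le> u"
  shows "x \<le> u"
  using LIMSEQ_nonneg[of "\<lambda>n. u - X n" "u - x"] assms by (simp add: tendsto_diff)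

lemma suminf_nonneg_lattice:
  fixes f :: "nat \<Rightarrow> 'a::banach_lattice"
  assumes "summable f" "\<And>n. 0 \<le> f n"
  shows "0 \<le> suminf f"
  using assms by (intro LIMSEQ_nonneg[OF summable_LIMSEQ]) (auto intro: sum_nonneg)

lemma le_suminf_lattice:
  fixes f :: "nat \<Rightarrow> 'a::banach_lattice"
  assumes "summable f" "\<And>n. 0 \<le> f n"
  shows "f n \<le> suminf f"
proof -
  have "0 \<le> (\<Sum>k. f (k + Suc n))"
    using assms by (intro suminf_nonneg_lattice) (auto simp: summable_iff_shift[of f "Suc n"] simp del: add_Suc_right)
  moreover have "f n \<le> (\<Sum>k<Suc n. f k)"
    using assms by (simp add: sum_nonneg)
  ultimately show ?thesis
    using suminf_split_initial_segment[OF assms(1), of "Suc n"] by (metis add_increasing)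
qed

lemma bounded_seq_dominated:
  fixes x :: "nat \<Rightarrow> 'a::banach_lattice"
  assumes "bounded (range x)"
  obtains z where "0 \<le> z" "\<And>n. \<bar>x n\<bar> \<le> 2 ^ n *\<^sub>R z"
proof
  let ?f = "\<lambda>n. (1 / 2) ^ n *\<^sub>R \<bar>x n\<bar>"
  obtain K where K: "\<And>n. norm (x n) \<le> K"
    using assms by (auto simp: bounded_iff)
  have "summable ?f"
  proof (rule summable_comparison_test')
    show "summable (\<lambda>n. K * (1 / 2 :: real) ^ n)"
      by (intro summable_mult summable_geometric) simp
    show "norm (?f n) \<le> K * (1 / 2) ^ n" for n
      using K[of n] by (simp add: field_simps)
  qed
  moreover have pos: "0 \<le> ?f n" for n
    by (intro scaleR_nonneg_nonneg) auto
  ultimately show "0 \<le> suminf ?f"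
    by (rule suminf_nonneg_lattice)
  have "?f n \<le> suminf ?f" for n
    using \<open>summable ?f\<close> pos by (rule le_suminf_lattice)
  then show "\<bar>x n\<bar> \<le> 2 ^ n *\<^sub>R suminf ?f" for n
    using scaleR_left_mono[of "?f n" "suminf ?f" "2 ^ n"] by (simp add: power_divide)
qed

section \<open>Disjointly weakly compact sets\<close>

lemma weakly_Cauchy_subseq:
  assumes "weakly_Cauchy x" "strict_mono r"
  shows "weakly_Cauchy (x \<circ> r)"
  using assms Cauchy_subseq_Cauchy[of _ r] unfolding weakly_Cauchy_def
  by (force simp: o_def)

text \<open>The series of \<open>\<bar>\<phi> (x n)\<bar>\<close> converges: its partial sums are
  values of \<open>\<phi>\<close> at sums of the \<open>x n\<close> with suitable signs, and
  disjointness keeps the modulus of such sums below \<open>u\<close>.\<close>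

lemma weakly_null_disjoint_dominated:
  fixes x :: "nat \<Rightarrow> 'a::banach_lattice"
  assumes disj: "disjoint_seq x" and le: "\<And>n. \<bar>x n\<bar> \<le> u"
  shows "weakly_null x"
  unfolding weakly_null_def
proof (intro allI impI)
  fix \<phi> :: "'a \<Rightarrow> real" assume "bounded_linear \<phi>"
  then interpret bounded_linear \<phi> .
  obtain K where K: "0 \<le> K" "\<And>x. norm (\<phi> x) \<le> norm x * K"
    using nonneg_bounded by blast
  have "(\<Sum>n<N. \<bar>\<phi> (x n)\<bar>) \<le> norm u * K" for N
  proof -
    let ?y = "\<Sum>n<N. sgn (\<phi> (x n)) *\<^sub>R x n"
    have "\<bar>?y\<bar> \<le> (\<Sum>n<N. \<bar>x n\<bar>)"
    proof (rule order_trans[OF sum_abs sum_mono])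
      fix n
      have "\<bar>sgn (\<phi> (x n)) *\<^sub>R x n\<bar> \<le> \<bar>sgn (\<phi> (x n))\<bar> *\<^sub>R \<bar>x n\<bar>"
        by (rule abs_scaleR_le)
      also have "\<dots> \<le> \<bar>x n\<bar>"
        by (simp add: sgn_real_def)
      finally show "\<bar>sgn (\<phi> (x n)) *\<^sub>R x n\<bar> \<le> \<bar>x n\<bar>" .
    qed
    also have "\<dots> \<le> u"
      using disj le by (intro sum_disjoint_le) (auto simp: disjoint_seq_def)
    finally have "norm ?y \<le> norm u"
      by (rule norm_le_if_abs_le)
    have "(\<Sum>n<N. \<bar>\<phi> (x n)\<bar>) = \<phi> ?y"
      by (simp add: sum scaleR abs_sgn mult.commute)
    also have "\<dots> \<le> norm ?y * K"
      using K(2)[of ?y] by simp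
    also have "\<dots> \<le> norm u * K"
      using \<open>norm ?y \<le> norm u\<close> K(1) by (rule mult_right_mono)
    finally show ?thesis .
  qed
  then have "summable (\<lambda>n. \<bar>\<phi> (x n)\<bar>)"
    by (intro summableI_nonneg_bounded) auto
  then show "(\<lambda>n. \<phi> (x n)) \<longlonglongrightarrow> 0"
    using summable_LIMSEQ_zero tendsto_rabs_zero_iff by blast
qed

lemma disjointly_weakly_compact_if_dominated:
  fixes A :: "'a::banach_lattice set"
  assumes "\<And>x. x \<in> A \<Longrightarrow> \<bar>x\<bar> \<le> u"
  shows "disjointly_weakly_compact A"
  unfolding disjointly_weakly_compact_def
proof (intro conjI allI impI)
  show "bounded A"
    unfolding bounded_iff using assms norm_le_if_abs_le by blast
  fix x :: "nat \<Rightarrow> 'a" assume "range x \<subseteq> solid_hull A" "disjoint_seq x"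
  then show "weakly_null x"
    using assms by (intro weakly_null_disjoint_dominated[of x u])
      (force simp: solid_hull_def image_subset_iff intro: order_trans)+
qed

text \<open>
  If the conclusion fails for \<open>\<epsilon>\<close>, choose greedily terms \<open>y\<^sub>k\<close> of the sequence violating it for
  multiples \<open>c\<^sub>k z \<ge> 4\<^sup>k \<bar>y\<^sub>j\<bar>\<close> (\<open>j < k\<close>). Truncating the remainders once more, at \<open>2\<^sup>-\<^sup>k w\<close> with
  \<open>\<bar>y\<^sub>k\<bar> \<le> 2\<^sup>k w\<close> for all \<open>k\<close>, makes them disjoint and changes \<open>\<phi>\<close> by a null sequence.
\<close>

lemma disjointly_weakly_compact_clip:
  fixes A :: "'a::banach_lattice set"
  assumes A: "disjointly_weakly_compact A" and x: "range x \<subseteq> A"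
    and z: "0 \<le> z" "\<And>n. \<bar>x n\<bar> \<le> 2 ^ n *\<^sub>R z"
    and \<phi>: "bounded_linear (\<phi> :: 'a \<Rightarrow> real)" and "0 < \<epsilon>"
  shows "\<exists>k::nat. \<forall>n. \<bar>\<phi> (x n - clip (real k *\<^sub>R z) (x n))\<bar> < \<epsilon>"
proof (rule ccontr)
  interpret bounded_linear \<phi> by (rule \<phi>)
  assume "\<not> ?thesis"
  \<comment> \<open>\<open>Q k\<close> is the index of a term that violates the bound at truncation
    level \<open>k\<close>.\<close>
  then obtain Q where Q: "\<And>k::nat. \<epsilon> \<le> \<bar>\<phi> (x (Q k) - clip (real k *\<^sub>R z) (x (Q k)))\<bar>"
    by (metis linorder_not_less)
  \<comment> \<open>The factor \<open>2 ^ Q c\<close> compensates the one in \<open>z(2)\<close> for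
    the term just chosen. Keeping the factor \<open>c\<close> preserves the bounds for all earlier
    terms.\<close>
  define c :: "nat \<Rightarrow> nat" where
    "c = rec_nat 1 (\<lambda>k c. 4 ^ Suc k * 2 ^ Q c * c)"
  have c_Suc: "c (Suc k) = 4 ^ Suc k * 2 ^ Q (c k) * c k" for k
    by (simp add: c_def)
  have c_pos: "1 \<le> c k" for k
    by (induction k) (simp_all add: c_def Suc_le_eq)
  have c_ge: "4 ^ k * 2 ^ Q (c j) \<le> c k" if "j < k" for j k
    using that
  proof (induction k)
    case (Suc k)
    show ?case
    proof (cases "j = k")
      case True
      then show ?thesis using c_pos[of k] by (simp add: c_Suc)
    next
      case False
      with Suc have "4 ^ k * 2 ^ Q (c j) \<le> c k" by simp
      \<comment> \<open>The 1 is compared with \<open>4 ^ k * 2 ^ Q (c k)\<close>; the remaining 4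
        raises the exponent from \<open>k\<close> to \<open>Suc k\<close>.\<close>
      then have "4 * 1 * (4 ^ k * 2 ^ Q (c j)) \<le> 4 * (4 ^ k * 2 ^ Q (c k)) * c k"
        by (intro mult_mono) (auto simp: Suc_le_eq)
      then show ?thesis by (simp add: c_Suc mult_ac)
    qed
  qed simp
  define y where "y k = x (Q (c k))" for k
  define u where "u k = real (c k) *\<^sub>R z" for k
  define v where "v k = y k - clip (u k) (y k)" for k
  have u0: "0 \<le> u k" for k
    using z(1) by (simp add: u_def scaleR_nonneg_nonneg)
  have u_ge: "4 ^ k *\<^sub>R \<bar>y j\<bar> \<le> u k" if "j < k" for j k
  proof -
    have "4 ^ k *\<^sub>R \<bar>y j\<bar> \<le> 4 ^ k *\<^sub>R 2 ^ Q (c j) *\<^sub>R z"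
      unfolding y_def by (intro scaleR_left_mono z) simp
    also have "\<dots> = real (4 ^ k * 2 ^ Q (c j)) *\<^sub>R z"
      by simp
    also have "\<dots> \<le> u k"
      unfolding u_def using c_ge[OF that] z(1) by (intro scaleR_right_mono of_nat_mono)
    finally show ?thesis .
  qed
  have yA: "y k \<in> A" for k
    using x by (auto simp: y_def)
  then have "bounded (range y)"
    using A bounded_subset[of A "range y"] by (auto simp: disjointly_weakly_compact_def)
  \<comment> \<open>The element \<open>z\<close> only gives the coefficient
    \<open>2 ^ Q (c k)\<close>. A new dominating element for the chosen terms gives
    \<open>2 ^ k\<close>, with no dependence on \<open>Q\<close>.\<close>
  then obtain w where w: "0 \<le> w" "\<And>k. \<bar>y k\<bar> \<le> 2 ^ k *\<^sub>R w"
    using bounded_seq_dominated by blast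
  define w' where "w' k = (1 / 2) ^ k *\<^sub>R w" for k :: nat
  have w'0: "0 \<le> w' k" for k
    using w(1) by (simp add: w'_def scaleR_nonneg_nonneg)
  define v' where "v' k = v k - clip (w' k) (v k)" for k
  have v_le: "\<bar>v k\<bar> \<le> sup 0 (\<bar>y k\<bar> - u k)" "\<bar>v k\<bar> \<le> \<bar>y k\<bar>" for k
    unfolding v_def using abs_diff_clip_le abs_diff_clip_le_abs[OF u0] by blast+
  have v'_le: "\<bar>v' k\<bar> \<le> sup 0 (\<bar>v k\<bar> - w' k)" "\<bar>v' k\<bar> \<le> \<bar>v k\<bar>" for k
    unfolding v'_def using abs_diff_clip_le abs_diff_clip_le_abs[OF w'0] by blast+
  have disj: "inf \<bar>v' j\<bar> \<bar>v' k\<bar> = 0" if "j < k" for j k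
  proof (rule inf_eq_0_mono)
    \<comment> \<open>This \<open>?t\<close> balances both truncations:
      \<open>?t *\<^sub>R \<bar>y k\<bar>\<close> is at most the level \<open>w' j\<close> used for
      \<open>v' j\<close>, and \<open>1 / ?t\<close> is at most \<open>4 ^ k\<close>, the factor
      that the level \<open>u k\<close> absorbs.\<close>
    let ?t = "(1 / 2) ^ j * (1 / 2) ^ k :: real"
    show "inf (sup 0 (\<bar>y j\<bar> - ?t *\<^sub>R \<bar>y k\<bar>)) (sup 0 (\<bar>y k\<bar> - (1 / ?t) *\<^sub>R \<bar>y j\<bar>)) = 0"
      by (rule inf_sup_diff_eq_0) (simp_all add: mult_le_one power_le_one)
    have "?t *\<^sub>R \<bar>y k\<bar> \<le> ?t *\<^sub>R 2 ^ k *\<^sub>R w"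
      by (intro scaleR_left_mono w) simp
    also have "\<dots> = w' j"
      by (simp add: w'_def power_divide)
    finally show "\<bar>v' j\<bar> \<le> sup 0 (\<bar>y j\<bar> - ?t *\<^sub>R \<bar>y k\<bar>)"
      using v_le(2)[of j] by (intro order_trans[OF v'_le(1)] sup_mono diff_mono) auto
    have "(2::real) ^ j \<le> 2 ^ k"
      using that by (intro power_increasing) auto
    then have "1 / ?t \<le> 2 ^ k * 2 ^ k"
      by (simp add: power_divide)
    also have "\<dots> = (4::real) ^ k"
      by (simp flip: power_mult_distrib)
    finally have "(1 / ?t) *\<^sub>R \<bar>y j\<bar> \<le> 4 ^ k *\<^sub>R \<bar>y j\<bar>"
      by (intro scaleR_right_mono) auto
    also note u_ge[OF that]
    finally show "\<bar>v' k\<bar> \<le> sup 0 (\<bar>y k\<bar> - (1 / ?t) *\<^sub>R \<bar>y j\<bar>)"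
      by (intro order_trans[OF v'_le(2)] order_trans[OF v_le(1)] sup_mono diff_mono) auto
  qed auto
  have "disjoint_seq v'"
    unfolding disjoint_seq_def using disj by (metis inf_commute linorder_neqE_nat)
  moreover have "range v' \<subseteq> solid_hull A"
    using order_trans[OF v'_le(2) v_le(2)] yA by (auto simp: solid_hull_def)
  ultimately have "weakly_null v'"
    using A by (simp add: disjointly_weakly_compact_def)
  then have "(\<lambda>k. \<phi> (v' k)) \<longlonglongrightarrow> 0"
    using \<phi> by (simp add: weakly_null_def)
  moreover have "(\<lambda>k. \<phi> (clip (w' k) (v k))) \<longlonglongrightarrow> 0"
  proof (rule tendsto_zero, rule Lim_null_comparison)
    show "\<forall>\<^sub>F k in sequentially. norm (clip (w' k) (v k)) \<le> (1 / 2) ^ k * norm w"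
      using norm_le_if_abs_le[OF abs_clip_le[OF w'0]] by (intro always_eventually) (simp add: w'_def)
    show "(\<lambda>k. (1 / 2) ^ k * norm w) \<longlonglongrightarrow> 0"
      by (intro tendsto_mult_left_zero LIMSEQ_realpow_zero) auto
  qed
  ultimately have "(\<lambda>k. \<phi> (v' k) + \<phi> (clip (w' k) (v k))) \<longlonglongrightarrow> 0"
    by (rule tendsto_add_zero)
  then have "(\<lambda>k. \<phi> (v k)) \<longlonglongrightarrow> 0"
    by (simp add: v'_def diff)
  then have "\<forall>\<^sub>F k in sequentially. \<bar>\<phi> (v k)\<bar> < \<epsilon>"
    using \<open>0 < \<epsilon>\<close> by (auto simp: tendsto_iff)
  then obtain k where "\<bar>\<phi> (v k)\<bar> < \<epsilon>"
    using eventually_happens by force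
  then show False
    using Q[of "c k"] by (simp add: v_def y_def u_def)
qed

lemma weakly_precompact_if_disjointly_weakly_compact:
  fixes A :: "'a::banach_lattice set"
  assumes intervals: "\<And>a b :: 'a. weakly_precompact {a..b}"
    and A: "disjointly_weakly_compact A"
  shows "weakly_precompact A"
  unfolding weakly_precompact_def
proof (intro conjI allI impI)
  show "bounded A"
    using A by (simp add: disjointly_weakly_compact_def)
  fix x :: "nat \<Rightarrow> 'a" assume x: "range x \<subseteq> A"
  with \<open>bounded A\<close> have "bounded (range x)"
    by (rule bounded_subset)
  then obtain z where z: "0 \<le> z" "\<And>n. \<bar>x n\<bar> \<le> 2 ^ n *\<^sub>R z"
    using bounded_seq_dominated by blast
  let ?y = "\<lambda>k n. clip (real k *\<^sub>R z) (x n)"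
  interpret subseqs "\<lambda>k r. weakly_Cauchy (?y k \<circ> r)"
  proof
    fix k and s :: "nat \<Rightarrow> nat"
    have "range (?y k \<circ> s) \<subseteq> {- (real k *\<^sub>R z)..real k *\<^sub>R z}"
      using clip_mem[of "real k *\<^sub>R z"] z(1) by (auto simp: scaleR_nonneg_nonneg)
    then show "\<exists>r. strict_mono r \<and> weakly_Cauchy (?y k \<circ> (s \<circ> r))"
      using intervals unfolding weakly_precompact_def by (metis comp_assoc)
  qed
  \<comment> \<open>Level \<open>k\<close> is settled by the refinement numbered
    \<open>Suc k\<close>, of which the diagonal is a subsequence only from index
    \<open>Suc k\<close> on; hence the shift.\<close>
  have diag: "weakly_Cauchy (?y k \<circ> (diagseq \<circ> (+) (Suc k)))" for k
    by (rule diagseq_holds) (metis comp_assoc weakly_Cauchy_subseq)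
  have "Cauchy (\<lambda>n. \<phi> ((x \<circ> diagseq) n))" if \<phi>: "bounded_linear \<phi>" for \<phi> :: "'a \<Rightarrow> real"
  proof (rule metric_CauchyI)
    interpret bounded_linear \<phi> by (rule \<phi>)
    fix \<epsilon> :: real assume "0 < \<epsilon>"
    \<comment> \<open>One level \<open>k\<close> serves all \<open>n\<close>. Two truncation errors
      and one Cauchy difference then share \<open>\<epsilon>\<close>.\<close>
    then obtain k where k: "\<And>n. \<bar>\<phi> (x n - ?y k n)\<bar> < \<epsilon> / 3"
      using disjointly_weakly_compact_clip[OF A x z \<phi>, of "\<epsilon> / 3"] by auto
    have "Cauchy (\<lambda>n. \<phi> (?y k (diagseq (Suc k + n))))"
      using diag[of k] \<phi> by (simp add: weakly_Cauchy_def)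
    from metric_CauchyD[OF this, of "\<epsilon> / 3"] \<open>0 < \<epsilon>\<close>
    obtain M where M: "\<And>m n. M \<le> m \<Longrightarrow> M \<le> n \<Longrightarrow>
        \<bar>\<phi> (?y k (diagseq (Suc k + m))) - \<phi> (?y k (diagseq (Suc k + n)))\<bar> < \<epsilon> / 3"
      unfolding dist_real_def by (metis zero_less_divide_iff zero_less_numeral)
    have "\<bar>\<phi> (x (diagseq m)) - \<phi> (x (diagseq n))\<bar> < \<epsilon>" if "Suc k + M \<le> m" "Suc k + M \<le> n" for m n
    proof -
      have "M \<le> m - Suc k" "M \<le> n - Suc k"
        using that by auto
      from M[OF this] have "\<bar>\<phi> (?y k (diagseq m)) - \<phi> (?y k (diagseq n))\<bar> < \<epsilon> / 3"
        using that by simp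
      with k[of "diagseq m"] k[of "diagseq n"] show ?thesis
        unfolding diff by linarith
    qed
    then show "\<exists>M. \<forall>m\<ge>M. \<forall>n\<ge>M. dist (\<phi> ((x \<circ> diagseq) m)) (\<phi> ((x \<circ> diagseq) n)) < \<epsilon>"
      unfolding dist_real_def by (intro exI[of _ "Suc k + M"]) auto
  qed
  then have "weakly_Cauchy (x \<circ> diagseq)"
    by (simp add: weakly_Cauchy_def)
  then show "\<exists>r. strict_mono r \<and> weakly_Cauchy (x \<circ> r)"
    using subseq_diagseq by blast
qed

section \<open>Weakly precompact operators\<close>

lemma weakly_precompact_subset:
  assumes "weakly_precompact S" "A \<subseteq> S"
  shows "weakly_precompact A"
  using assms bounded_subset unfolding weakly_precompact_def by blast

lemma weakly_Cauchy_bounded_linear: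
  assumes "bounded_linear f" "weakly_Cauchy x"
  shows "weakly_Cauchy (f \<circ> x)"
  using assms bounded_linear_compose unfolding weakly_Cauchy_def by force

lemma weakly_precompact_bounded_linear_image:
  assumes f: "bounded_linear f" and S: "weakly_precompact S"
  shows "weakly_precompact (f ` S)"
  unfolding weakly_precompact_def
proof (intro conjI allI impI)
  show "bounded (f ` S)"
    using S f by (simp add: weakly_precompact_def bounded_linear_image)
  fix y :: "nat \<Rightarrow> 'b" assume "range y \<subseteq> f ` S"
  then have "\<forall>n. \<exists>x. x \<in> S \<and> y n = f x" by auto
  then obtain x where x: "\<And>n. x n \<in> S" "\<And>n. y n = f (x n)" by metis
  then obtain r :: "nat \<Rightarrow> nat" where r: "strict_mono r" "weakly_Cauchy (x \<circ> r)"
    using S unfolding weakly_precompact_def by (metis image_subset_iff)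
  have "y \<circ> r = f \<circ> (x \<circ> r)" using x by auto
  then show "\<exists>r. strict_mono r \<and> weakly_Cauchy (y \<circ> r)"
    using r weakly_Cauchy_bounded_linear[OF f] by metis
qed

text \<open>Bridges the two operator notions, one tested on the unit ball and the other on all
  bounded sets: a bounded set lies in a multiple of the ball, and weak precompactness survives
  scaling.\<close>

lemma weakly_precompact_operator_if_unit_ball:
  assumes X: "banach_space X" and T: "bounded_operator X T"
    and ball: "weakly_precompact (T ` nvs_unit_ball X)"
  shows "weakly_precompact_operator X T"
  unfolding weakly_precompact_operator_def
proof (intro conjI allI impI T)
  interpret banach_space X by (rule X)
  fix A assume "nvs_bounded X A"
  then obtain K where A: "A \<subseteq> nvs_carrier X" and K: "\<And>x. x \<in> A \<Longrightarrow> nvs_norm X x \<le> K"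
    by (auto simp: nvs_bounded_def)
  \<comment> \<open>The maximum makes the divisor positive even if \<open>K\<close> is not.\<close>
  define C where "C = max K 1"
  have "T ` A \<subseteq> (*\<^sub>R) C ` T ` nvs_unit_ball X"
  proof
    fix v assume "v \<in> T ` A"
    then obtain x where x: "x \<in> A" "v = T x" by auto
    let ?y = "nvs_scale X (1 / C) x"
    have C: "0 < C" and xX: "x \<in> nvs_carrier X"
      using x A by (auto simp: C_def)
    have "nvs_norm X x \<le> C" using K x by (force simp: C_def)
    then have "?y \<in> nvs_unit_ball X"
      using xX C by (simp add: nvs_unit_ball_def scale_closed norm_scale)
    moreover have "T ?y = (1 / C) *\<^sub>R T x"
      using T xX by (simp add: bounded_operator_def)
    then have "v = C *\<^sub>R T ?y"
      using C x by simp
    ultimately show "v \<in> (*\<^sub>R) C ` T ` nvs_unit_ball X" by blast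
  qed
  then show "weakly_precompact (T ` A)"
    using weakly_precompact_bounded_linear_image[OF bounded_linear_scaleR_right ball]
      weakly_precompact_subset by blast
qed

section \<open>Operators on \<open>\<ell>\<^sub>1\<close>\<close>

definition ell1_basis :: "nat \<Rightarrow> nat \<Rightarrow> real" where
  "ell1_basis k = (\<lambda>n. if n = k then 1 else 0)"

text \<open>For bounded \<open>x\<close>, the bounded operator on \<open>ell1\<close> with
  prescribed values \<open>x k\<close> at the unit vectors.\<close>

definition ell1_op :: "(nat \<Rightarrow> 'a::banach) \<Rightarrow> (nat \<Rightarrow> real) \<Rightarrow> 'a" where
  "ell1_op x a = (\<Sum>n. a n *\<^sub>R x n)"

lemma ell1_op_basis: "ell1_op x (ell1_basis k) = x k"
proof -
  have "(\<lambda>n. ell1_basis k n *\<^sub>R x n) = (\<lambda>n. if n = k then x n else 0)"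
    by (auto simp: ell1_basis_def)
  then show ?thesis
    using sums_single[of k x] by (simp add: ell1_op_def sums_iff)
qed

lemma ell1_basis_bounded: "nvs_bounded ell1 (range ell1_basis)"
proof -
  have "(\<lambda>n. \<bar>ell1_basis k n\<bar>) sums 1" for k
    using sums_single[of k "\<lambda>_. 1 :: real"] by (simp add: ell1_basis_def if_distrib cong: if_cong)
  then show ?thesis
    by (auto simp: nvs_bounded_def ell1_def sums_iff)
qed

lemma bounded_operator_ell1_op:
  fixes x :: "nat \<Rightarrow> 'a::banach"
  assumes "\<And>n. norm (x n) \<le> K"
  shows ell1_op_summable: "a \<in> nvs_carrier ell1 \<Longrightarrow> summable (\<lambda>n. a n *\<^sub>R x n)"
    and "bounded_operator ell1 (ell1_op x)"
proof -
  have le: "norm (a n *\<^sub>R x n) \<le> K * \<bar>a n\<bar>" for a :: "nat \<Rightarrow> real" and n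
    using mult_left_mono[OF assms, of "\<bar>a n\<bar>"] by (simp add: mult.commute)
  have norm_summable: "summable (\<lambda>n. norm (a n *\<^sub>R x n))" if "a \<in> nvs_carrier ell1" for a
  proof (rule summable_comparison_test')
    show "summable (\<lambda>n. K * \<bar>a n\<bar>)"
      using that by (intro summable_mult) (simp add: ell1_def)
    show "norm (norm (a n *\<^sub>R x n)) \<le> K * \<bar>a n\<bar>" for n
      using le by simp
  qed
  show summable: "summable (\<lambda>n. a n *\<^sub>R x n)" if "a \<in> nvs_carrier ell1" for a
    using norm_summable[OF that] by (rule summable_norm_cancel)
  have "norm (ell1_op x a) \<le> K * nvs_norm ell1 a" if a: "a \<in> nvs_carrier ell1" for a
  proof -
    have s: "summable (\<lambda>n. \<bar>a n\<bar>)" using a by (simp add: ell1_def)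
    have "norm (ell1_op x a) \<le> (\<Sum>n. norm (a n *\<^sub>R x n))"
      unfolding ell1_op_def by (rule summable_norm[OF norm_summable[OF a]])
    also have "\<dots> \<le> (\<Sum>n. K * \<bar>a n\<bar>)"
      by (intro suminf_le le norm_summable[OF a] summable_mult[OF s])
    finally show ?thesis
      by (simp add: ell1_def suminf_mult[OF s])
  qed
  moreover have "ell1_op x (nvs_add ell1 a b) = ell1_op x a + ell1_op x b"
    if "a \<in> nvs_carrier ell1" "b \<in> nvs_carrier ell1" for a b
    using suminf_add[OF summable[OF that(1)] summable[OF that(2)]]
    by (simp add: ell1_op_def ell1_def scaleR_left_distrib)
  moreover have "ell1_op x (nvs_scale ell1 c a) = c *\<^sub>R ell1_op x a"
    if "a \<in> nvs_carrier ell1" for a c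
    using suminf_scaleR_right[OF summable[OF that], of c]
    by (simp add: ell1_op_def ell1_def)
  ultimately show "bounded_operator ell1 (ell1_op x)"
    unfolding bounded_operator_def by blast
qed

text \<open>On the unit ball the partial sums have modulus at most the sum of the
  \<open>\<bar>a n\<bar>\<close> times \<open>u\<close>, hence at most \<open>u\<close>. The bound
  passes to the limit because the positive cone is closed, so the image of the ball is dominated by
  \<open>u\<close>.\<close>

lemma ell1_op_order_interval:
  fixes x :: "nat \<Rightarrow> 'a::banach_lattice"
  assumes pos: "\<And>n. 0 \<le> x n" and le: "\<And>n. x n \<le> u"
  shows "positive_on_ell1 (ell1_op x)"
    and "disjointly_weakly_compact_operator ell1 (ell1_op x)"
proof -
  have nx: "norm (x n) \<le> norm u" for n
    using pos le by (rule norm_mono_nonneg)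
  note summable = ell1_op_summable[OF nx]
  show "positive_on_ell1 (ell1_op x)"
    unfolding positive_on_ell1_def ell1_op_def
    using pos by (auto intro!: suminf_nonneg_lattice summable scaleR_nonneg_nonneg)
  have u: "0 \<le> u" using pos[of 0] le[of 0] by simp
  have "\<bar>ell1_op x a\<bar> \<le> u" if "a \<in> nvs_unit_ball ell1" for a
  proof -
    have a: "a \<in> nvs_carrier ell1" and s: "summable (\<lambda>n. \<bar>a n\<bar>)" "(\<Sum>n. \<bar>a n\<bar>) \<le> 1"
      using that by (auto simp: nvs_unit_ball_def ell1_def)
    have part: "\<bar>\<Sum>n<N. a n *\<^sub>R x n\<bar> \<le> u" for N
    proof -
      have "\<bar>\<Sum>n<N. a n *\<^sub>R x n\<bar> \<le> (\<Sum>n<N. \<bar>a n\<bar> *\<^sub>R u)"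
      proof (rule order_trans[OF sum_abs sum_mono])
        fix n
        have "\<bar>a n *\<^sub>R x n\<bar> \<le> \<bar>a n\<bar> *\<^sub>R \<bar>x n\<bar>"
          by (rule abs_scaleR_le)
        also have "\<dots> \<le> \<bar>a n\<bar> *\<^sub>R u"
          using pos le by (intro scaleR_left_mono) auto
        finally show "\<bar>a n *\<^sub>R x n\<bar> \<le> \<bar>a n\<bar> *\<^sub>R u" .
      qed
      also have "\<dots> = (\<Sum>n<N. \<bar>a n\<bar>) *\<^sub>R u"
        by (simp add: scaleR_left.sum)
      also have "\<dots> \<le> 1 *\<^sub>R u"
        using s u sum_le_suminf[OF s(1), of "{..<N}"] by (intro scaleR_right_mono) auto
      finally show ?thesis by simp
    qed
    have lim: "(\<lambda>N. \<Sum>n<N. a n *\<^sub>R x n) \<longlonglongrightarrow> ell1_op x a"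
      unfolding ell1_op_def by (rule summable_LIMSEQ[OF summable[OF a]])
    show ?thesis
      using LIMSEQ_le_lattice[OF lim] LIMSEQ_le_lattice[OF tendsto_minus[OF lim]] part
      by (intro abs_leI) (auto simp: abs_le_iff)
  qed
  then have "disjointly_weakly_compact (ell1_op x ` nvs_unit_ball ell1)"
    by (intro disjointly_weakly_compact_if_dominated[where u = u]) auto
  then show "disjointly_weakly_compact_operator ell1 (ell1_op x)"
    using bounded_operator_ell1_op(2)[OF nx] by (simp add: disjointly_weakly_compact_operator_def)
qed

lemma weakly_precompact_interval_if_ell1_operators:
  fixes a b :: "'a::banach_lattice"
  assumes ops: "\<And>T :: (nat \<Rightarrow> real) \<Rightarrow> 'a. positive_on_ell1 T \<Longrightarrow>
      disjointly_weakly_compact_operator ell1 T \<Longrightarrow> weakly_precompact_operator ell1 T"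
  shows "weakly_precompact {a..b}"
  unfolding weakly_precompact_def
proof (intro conjI allI impI)
  have "norm x \<le> norm (b - a) + norm a" if "x \<in> {a..b}" for x
    using that norm_mono_nonneg[of "x - a" "b - a"] norm_triangle_ineq[of "x - a" a] by simp
  then show "bounded {a..b}"
    unfolding bounded_iff by blast
  fix x :: "nat \<Rightarrow> 'a" assume x: "range x \<subseteq> {a..b}"
  \<comment> \<open>Translation moves the sequence into the positive cone, where the operator is
    positive, and does not affect differences of values of a functional.\<close>
  define y where "y n = x n - a" for n
  have "0 \<le> y n" "y n \<le> b - a" for n
    using x by (auto simp: y_def image_subset_iff)
  then have "weakly_precompact_operator ell1 (ell1_op y)"
    by (intro ops ell1_op_order_interval)
  then have "weakly_precompact (ell1_op y ` range ell1_basis)"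
    using ell1_basis_bounded by (simp add: weakly_precompact_operator_def)
  moreover have "range y \<subseteq> ell1_op y ` range ell1_basis"
    using ell1_op_basis[of y] by (force simp: image_iff)
  ultimately obtain r where r: "strict_mono r" "weakly_Cauchy (y \<circ> r)"
    unfolding weakly_precompact_def by blast
  have "Cauchy (\<lambda>n. \<phi> ((x \<circ> r) n))" if "bounded_linear \<phi>" for \<phi> :: "'a \<Rightarrow> real"
  proof -
    interpret bounded_linear \<phi> by (rule that)
    have "Cauchy (\<lambda>n. \<phi> (y (r n)))"
      using r(2) that by (simp add: weakly_Cauchy_def)
    then show ?thesis
      by (simp add: Cauchy_def y_def diff dist_real_def)
  qed
  then show "\<exists>r. strict_mono r \<and> weakly_Cauchy (x \<circ> r)"
    using r(1) by (auto simp: weakly_Cauchy_def)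
qed

section \<open>Transport of Banach spaces along injections\<close>

lemma (in banach_space) Metric_space: "Metric_space (nvs_carrier X) (nvs_dist X)"
proof -
  let ?C = "nvs_carrier X" and ?z = "nvs_zero X"
  let ?add = "nvs_add X"
  let ?neg = "nvs_scale X (-1)"
  have neg: "?neg x \<in> ?C" if "x \<in> ?C" for x
    using that by (rule scale_closed)
  have scale_zero: "nvs_scale X 0 x = ?z" if x: "x \<in> ?C" for x
  proof -
    let ?o = "nvs_scale X 0 x"
    obtain y where y: "y \<in> ?C" "?add x y = ?z" using add_inverse[OF x] by blast
    have o: "?o \<in> ?C" using x by (rule scale_closed)
    \<comment> \<open>This reads \<open>0 x + 1 x = (0 + 1) x\<close>; adding the inverse
      \<open>y\<close> of \<open>x\<close> then isolates \<open>?o\<close>.\<close>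
    have "?add ?o x = x"
      using scale_add_left[OF x, of 0 1] by (simp add: scale_one x)
    then have "?add ?o (?add x y) = ?add x y"
      using add_assoc[OF o x y(1)] by simp
    then show ?thesis
      using y add_zero[OF o] by simp
  qed
  have right_neg: "?add x (?neg x) = ?z" if "x \<in> ?C" for x
    using scale_add_left[OF that, of 1 "-1"] by (simp add: scale_one scale_zero that)
  \<comment> \<open>The telescoping identity serves twice: with \<open>w\<close> zero it separates
    points, and with \<open>w\<close> a negative it gives the triangle inequality.\<close>
  have cancel: "?add (?add x (?neg y)) (?add y w) = ?add x w" if "x \<in> ?C" "y \<in> ?C" "w \<in> ?C" for x y w
  proof -
    have "?add (?add x (?neg y)) (?add y w) = ?add x (?add (?add (?neg y) y) w)"
      using that by (simp add: add_assoc neg add_closed)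
    also have "?add (?neg y) y = ?z"
      using that by (simp add: add_commute[of "?neg y"] neg right_neg)
    also have "?add ?z w = w"
      using that by (simp add: add_commute[of ?z] zero_closed add_zero)
    finally show ?thesis .
  qed
  show ?thesis
  proof
    show "0 \<le> nvs_dist X x y" for x y
      by (auto simp: nvs_dist_def norm_nonneg add_closed neg)
    show "nvs_dist X x y = nvs_dist X y x" for x y
    proof (cases "x \<in> ?C \<and> y \<in> ?C")
      case True
      then have "?neg (?add x (?neg y)) = ?add y (?neg x)"
        by (simp add: scale_add_right neg scale_scale scale_one add_commute)
      then show ?thesis
        using True norm_scale[of "?add x (?neg y)" "-1"] by (simp add: nvs_dist_def add_closed neg)
    qed (auto simp: nvs_dist_def)
  next
    fix x y assume C: "x \<in> ?C" "y \<in> ?C"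
    have "x = y" if "?add x (?neg y) = ?z"
    proof -
      have "x = ?add (?add x (?neg y)) (?add y ?z)"
        using cancel[OF C zero_closed] C by (simp add: add_zero)
      also have "\<dots> = y"
        using that C by (simp add: add_zero add_commute[of ?z] zero_closed)
      finally show ?thesis .
    qed
    then show "nvs_dist X x y = 0 \<longleftrightarrow> x = y"
      using C by (auto simp: nvs_dist_def norm_eq_zero add_closed neg right_neg)
    fix w assume w: "w \<in> ?C"
    have "nvs_norm X (?add (?add x (?neg y)) (?add y (?neg w)))
        \<le> nvs_norm X (?add x (?neg y)) + nvs_norm X (?add y (?neg w))"
      using C w by (intro norm_triangle add_closed neg)
    then show "nvs_dist X x w \<le> nvs_dist X x y + nvs_dist X y w"
      using C w by (simp add: nvs_dist_def cancel neg)
  qed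
qed

text \<open>Needed because the third statement concerns spaces over \<open>'u\<close>, while
  \<open>ell1\<close> has real sequences as elements. With \<open>f\<close> injective on the carrier
  this is an isometric copy of \<open>X\<close>, computed by pulling arguments back along
  \<open>g\<close>.\<close>

definition nvs_transport :: "('x \<Rightarrow> 'y) \<Rightarrow> 'x nvs \<Rightarrow> 'y nvs" where
  "nvs_transport f X = (let g = inv_into (nvs_carrier X) f in
     \<lparr> nvs_carrier = f ` nvs_carrier X,
       nvs_add = (\<lambda>x y. f (nvs_add X (g x) (g y))),
       nvs_zero = f (nvs_zero X),
       nvs_scale = (\<lambda>a x. f (nvs_scale X a (g x))),
       nvs_norm = (\<lambda>x. nvs_norm X (g x)) \<rparr>)"

locale transported_banach_space = banach_space X for X :: "'x nvs" +
  fixes f :: "'x \<Rightarrow> 'y"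
  assumes inj: "inj_on f (nvs_carrier X)"
begin

abbreviation "C \<equiv> nvs_carrier X"
abbreviation "Y \<equiv> nvs_transport f X"
abbreviation "g \<equiv> inv_into C f"

lemma transport_simps:
  "nvs_carrier Y = f ` C" "nvs_zero Y = f (nvs_zero X)"
  "x \<in> C \<Longrightarrow> y \<in> C \<Longrightarrow> nvs_add Y (f x) (f y) = f (nvs_add X x y)"
  "x \<in> C \<Longrightarrow> nvs_scale Y a (f x) = f (nvs_scale X a x)"
  "x \<in> C \<Longrightarrow> nvs_norm Y (f x) = nvs_norm X x"
  using inj by (simp_all add: nvs_transport_def Let_def)

lemma f_eq_iff: "x \<in> C \<Longrightarrow> y \<in> C \<Longrightarrow> f x = f y \<longleftrightarrow> x = y"
  using inj by (rule inj_on_eq_iff)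

lemma transport_dist: "x \<in> C \<Longrightarrow> y \<in> C \<Longrightarrow> nvs_dist Y (f x) (f y) = nvs_dist X x y"
  by (simp add: nvs_dist_def transport_simps scale_closed add_closed)

lemma transport_Metric_space: "Metric_space (nvs_carrier Y) (nvs_dist Y)"
proof -
  interpret M: Metric_space C "nvs_dist X" by (rule Metric_space)
  show ?thesis
  proof
    \<comment> \<open>Nonnegativity and symmetry are demanded on the whole type; off the carrier
      \<open>nvs_dist\<close> has the default value 0.\<close>
    show "0 \<le> nvs_dist Y x y" for x y
      by (cases "x \<in> f ` C \<and> y \<in> f ` C")
        (auto simp: transport_dist, auto simp: nvs_dist_def transport_simps)
    show "nvs_dist Y x y = nvs_dist Y y x" for x y
      by (cases "x \<in> f ` C \<and> y \<in> f ` C")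
        (auto simp: transport_dist M.commute, auto simp: nvs_dist_def transport_simps)
  qed (auto simp: transport_simps transport_dist f_eq_iff M.triangle)
qed

lemma transport_mcomplete: "Metric_space.mcomplete (nvs_carrier Y) (nvs_dist Y)"
proof -
  interpret MX: Metric_space C "nvs_dist X" by (rule Metric_space)
  interpret MY: Metric_space "nvs_carrier Y" "nvs_dist Y" by (rule transport_Metric_space)
  show ?thesis
    unfolding MY.mcomplete_def
  proof (intro allI impI)
    fix s assume s: "MY.MCauchy s"
    then have "\<forall>n. \<exists>x. x \<in> C \<and> s n = f x"
      unfolding MY.MCauchy_def by (auto simp: transport_simps image_subset_iff)
    then obtain t where t: "\<And>n. t n \<in> C" "\<And>n. s n = f (t n)" by metis
    then have "MX.MCauchy t"
      using s unfolding MY.MCauchy_def MX.MCauchy_def by (auto simp: transport_dist)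
    then obtain x where x: "limitin MX.mtopology t x sequentially"
      using complete unfolding MX.mcomplete_def by blast
    then have "x \<in> C"
      by (simp add: MX.limit_metric_sequentially)
    with x t have "limitin MY.mtopology s (f x) sequentially"
      unfolding MX.limit_metric_sequentially MY.limit_metric_sequentially
      by (simp add: transport_simps transport_dist)
    then show "\<exists>x. limitin MY.mtopology s x sequentially" ..
  qed
qed

lemma transport_banach_space: "banach_space Y"
proof
  show "\<exists>y\<in>nvs_carrier Y. nvs_add Y x y = nvs_zero Y" if x: "x \<in> nvs_carrier Y" for x
  proof -
    obtain x' where x': "x' \<in> C" "x = f x'" using x by (auto simp: transport_simps)
    then obtain y where "y \<in> C" "nvs_add X x' y = nvs_zero X" using add_inverse by blast
    then show ?thesis using x' by (auto simp: transport_simps intro!: bexI[of _ y])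
  qed
  show "nvs_scale Y (a + b) x = nvs_add Y (nvs_scale Y a x) (nvs_scale Y b x)"
    if "x \<in> nvs_carrier Y" for a b x
    using that by (auto simp: transport_simps scale_closed scale_add_left)
  show "Metric_space.mcomplete (nvs_carrier Y) (nvs_dist Y)"
    by (rule transport_mcomplete)
  show "nvs_add Y (nvs_add Y x y) w = nvs_add Y x (nvs_add Y y w)"
    if "x \<in> nvs_carrier Y" "y \<in> nvs_carrier Y" "w \<in> nvs_carrier Y" for x y w
    using that by (auto simp: transport_simps add_closed add_assoc)
  show "nvs_add Y x y = nvs_add Y y x" if "x \<in> nvs_carrier Y" "y \<in> nvs_carrier Y" for x y
    using that by (auto simp: transport_simps add_commute)
qed (auto simp: transport_simps f_eq_iff add_closed zero_closed scale_closed
    add_zero scale_add_right scale_scale scale_one norm_nonneg norm_eq_zero norm_scale norm_triangle)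

lemma transport_bounded_operator:
  assumes "bounded_operator X T"
  shows "bounded_operator Y (T \<circ> g)"
  using assms inj
  by (auto simp: bounded_operator_def transport_simps add_closed scale_closed)

lemma transport_unit_ball: "nvs_unit_ball Y = f ` nvs_unit_ball X"
  by (auto simp: nvs_unit_ball_def transport_simps)

lemma transport_image: "A \<subseteq> C \<Longrightarrow> (T \<circ> g) ` f ` A = T ` A"
  using inj by (force simp: image_iff)

lemma transport_disjointly_weakly_compact:
  assumes "disjointly_weakly_compact_operator X T"
  shows "disjointly_weakly_compact_operator Y (T \<circ> g)"
proof -
  have "(T \<circ> g) ` nvs_unit_ball Y = T ` nvs_unit_ball X"
    unfolding transport_unit_ball by (rule transport_image) (auto simp: nvs_unit_ball_def)
  then show ?thesis
    using assms transport_bounded_operator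
    unfolding disjointly_weakly_compact_operator_def by metis
qed

text \<open>The way back to \<open>X\<close>: \<open>f\<close> carries bounded sets to bounded sets,
  on which \<open>T \<circ> g\<close> has the same image as \<open>T\<close> on the original
  set.\<close>

lemma weakly_precompact_operator_if_transport:
  assumes T: "bounded_operator X T" and "weakly_precompact_operator Y (T \<circ> g)"
  shows "weakly_precompact_operator X T"
  unfolding weakly_precompact_operator_def
proof (intro conjI allI impI T)
  fix A assume A: "nvs_bounded X A"
  then have "nvs_bounded Y (f ` A)"
    by (fastforce simp: nvs_bounded_def transport_simps)
  then have "weakly_precompact ((T \<circ> g) ` f ` A)"
    using assms(2) unfolding weakly_precompact_operator_def by blast
  then show "weakly_precompact (T ` A)"
    using A transport_image[of A T] unfolding nvs_bounded_def by metis
qed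

end

text \<open>Coding reals as sets of naturals turns a sequence of reals into one set of coded pairs,
  from which each entry can be recovered as a section.\<close>

lemma real_sequences_lepoll_reals: "(UNIV :: (nat \<Rightarrow> real) set) \<lesssim> (UNIV :: real set)"
proof -
  obtain h :: "real \<Rightarrow> nat set" where h: "inj h"
    using eqpoll_imp_lepoll[OF eqpoll_sym[OF nat_sets_eqpoll_reals]] by (auto simp: lepoll_def)
  have "inj (\<lambda>a :: nat \<Rightarrow> real. {prod_encode (n, k) |n k. k \<in> h (a n)})"
  proof (rule injI)
    fix a b :: "nat \<Rightarrow> real"
    assume eq: "{prod_encode (n, k) |n k. k \<in> h (a n)} = {prod_encode (n, k) |n k. k \<in> h (b n)}"
    have "k \<in> h (a n) \<longleftrightarrow> k \<in> h (b n)" for n k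
      using arg_cong[OF eq, of "\<lambda>S. prod_encode (n, k) \<in> S"] by simp
    then have "h (a n) = h (b n)" for n by blast
    then show "a = b"
      using h by (auto simp: inj_eq)
  qed
  then have "(UNIV :: (nat \<Rightarrow> real) set) \<lesssim> (UNIV :: nat set set)"
    unfolding lepoll_def by blast
  also note nat_sets_eqpoll_reals
  finally show ?thesis .
qed

theorem corollary3p11:
  assumes universe: "(UNIV :: real set) \<lesssim> (UNIV :: 'u set)"
  shows
    "((\<forall>a b :: 'f::banach_lattice. weakly_precompact {a..b})
       \<longleftrightarrow> (\<forall>A :: 'f set. disjointly_weakly_compact A \<longrightarrow> weakly_precompact A))
     \<and>
     ((\<forall>A :: 'f set. disjointly_weakly_compact A \<longrightarrow> weakly_precompact A)
       \<longleftrightarrow> (\<forall>(X :: 'u nvs) (T :: 'u \<Rightarrow> 'f). banach_space X \<longrightarrow>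
             disjointly_weakly_compact_operator X T \<longrightarrow> weakly_precompact_operator X T))
     \<and>
     ((\<forall>(X :: 'u nvs) (T :: 'u \<Rightarrow> 'f). banach_space X \<longrightarrow>
             disjointly_weakly_compact_operator X T \<longrightarrow> weakly_precompact_operator X T)
       \<longleftrightarrow> (\<forall>T :: (nat \<Rightarrow> real) \<Rightarrow> 'f. positive_on_ell1 T \<longrightarrow>
             disjointly_weakly_compact_operator ell1 T \<longrightarrow> weakly_precompact_operator ell1 T))"
    (is "(?S1 \<longleftrightarrow> ?S2) \<and> (?S2 \<longleftrightarrow> ?S3) \<and> (?S3 \<longleftrightarrow> ?S4)")
proof -
  \<comment> \<open>The four implications are proved as a cycle.\<close>
  have "?S1 \<Longrightarrow> ?S2"
    using weakly_precompact_if_disjointly_weakly_compact by blast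
  moreover have "?S2 \<Longrightarrow> ?S3"
    using weakly_precompact_operator_if_unit_ball
    unfolding disjointly_weakly_compact_operator_def by blast
  moreover have ?S4 if S3: ?S3
  proof (intro allI impI)
    fix T :: "(nat \<Rightarrow> real) \<Rightarrow> 'f"
    assume T: "disjointly_weakly_compact_operator ell1 T"
    \<comment> \<open>The cardinality assumption on \<open>'u\<close> enters here: it provides room
      for a copy of \<open>ell1\<close>, to which the third statement applies.\<close>
    obtain f :: "(nat \<Rightarrow> real) \<Rightarrow> 'u" where "inj f"
      using lepoll_trans[OF real_sequences_lepoll_reals universe] by (auto simp: lepoll_def)
    then have "inj_on f (nvs_carrier ell1)"
      by (rule inj_on_subset) simp
    then interpret transported_banach_space ell1 f
      using banach_space_ell1
      by (simp add: transported_banach_space_def transported_banach_space_axioms_def)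
    have "weakly_precompact_operator Y (T \<circ> g)"
      using S3 transport_banach_space transport_disjointly_weakly_compact[OF T] by blast
    moreover have "bounded_operator ell1 T"
      using T by (simp add: disjointly_weakly_compact_operator_def)
    ultimately show "weakly_precompact_operator ell1 T"
      by (intro weakly_precompact_operator_if_transport)
  qed
  moreover have "?S4 \<Longrightarrow> ?S1"
    using weakly_precompact_interval_if_ell1_operators by blast
  ultimately show ?thesis by blast
qed

end
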